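(* Let $G$ be a finite non-associative conjugacy closed (CC) loop. Then the probability that three elements $x,y,z$ of $G$, chosen independently and uniformly at random, associate is at most $\frac{7}{8}$; that is, $$\frac{\left|\{(x,y,z)\in G^3 : (xy)z = x(yz)\}\right|}{|G|^3}\leq \frac{7}{8}.$$
   Context: A quasigroup is a set with a binary operation such that for all $a,b$ each of the equations $ax=b$ and $xa=b$ has a unique solution $x$. A loop is a quasigroup with a two-sided identity element $1$. For $x$ in a loop $G$, let $L_x,R_x:G\to G$ be the bijections $L_x(y)=xy$ and $R_x(y)=yx$. A loop $G$ is a conjugacy closed loop (CC loop) if for all $x,y,z\in G$ both identities hold: $$z(xy) = R_z^{-1}(zx)\cdot (zy), \qquad (xy)z = (xz)\cdot L_z^{-1}(yz).$$ Non-associative means that $(xy)z\neq x(yz)$ for some $x,y,z\in G$. Elements $x,y,z$ associate if $(xy)z=x(yz)$. *)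

theory Defs
  imports Complex_Main "HOL-Algebra.Group"
begin

text \<open>
  The record type \<^typ>\<open>'a monoid\<close> only supplies a carrier, a binary operation and a
  distinguished element; it carries no associativity assumption. The unit field is left
  unconstrained by \<open>quasigroup\<close>.
\<close>

locale quasigroup =
  fixes G (structure)
  assumes m_closed [intro, simp]:
      "\<lbrakk>x \<in> carrier G; y \<in> carrier G\<rbrakk> \<Longrightarrow> x \<otimes> y \<in> carrier G"
    and left_div: "\<lbrakk>a \<in> carrier G; b \<in> carrier G\<rbrakk> \<Longrightarrow> \<exists>!x. x \<in> carrier G \<and> a \<otimes> x = b"
    and right_div: "\<lbrakk>a \<in> carrier G; b \<in> carrier G\<rbrakk> \<Longrightarrow> \<exists>!x. x \<in> carrier G \<and> x \<otimes> a = b"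

locale loop = quasigroup +
  assumes one_closed [intro, simp]: "\<one> \<in> carrier G"
    and l_one [simp]: "x \<in> carrier G \<Longrightarrow> \<one> \<otimes> x = x"
    and r_one [simp]: "x \<in> carrier G \<Longrightarrow> x \<otimes> \<one> = x"

definition left_translation :: "('a, 'b) monoid_scheme \<Rightarrow> 'a \<Rightarrow> 'a \<Rightarrow> 'a"
  where "left_translation G x y = x \<otimes>\<^bsub>G\<^esub> y"

definition right_translation :: "('a, 'b) monoid_scheme \<Rightarrow> 'a \<Rightarrow> 'a \<Rightarrow> 'a"
  where "right_translation G x y = y \<otimes>\<^bsub>G\<^esub> x"

lemma (in quasigroup) bij_betw_left_translation:
  assumes "x \<in> carrier G"
  shows "bij_betw (left_translation G x) (carrier G) (carrier G)"
  unfolding bij_betw_def inj_on_def left_translation_def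
  using assms left_div m_closed by (auto simp: image_iff) metis+

lemma (in quasigroup) bij_betw_right_translation:
  assumes "x \<in> carrier G"
  shows "bij_betw (right_translation G x) (carrier G) (carrier G)"
  unfolding bij_betw_def inj_on_def right_translation_def
  using assms right_div m_closed by (auto simp: image_iff) metis+

locale cc_loop = loop +
  assumes left_cc: "\<lbrakk>x \<in> carrier G; y \<in> carrier G; z \<in> carrier G\<rbrakk> \<Longrightarrow>
      z \<otimes> (x \<otimes> y) = inv_into (carrier G) (right_translation G z) (z \<otimes> x) \<otimes> (z \<otimes> y)"
    and right_cc: "\<lbrakk>x \<in> carrier G; y \<in> carrier G; z \<in> carrier G\<rbrakk> \<Longrightarrow>
      (x \<otimes> y) \<otimes> z = (x \<otimes> z) \<otimes> inv_into (carrier G) (left_translation G z) (y \<otimes> z)"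

end

theory Submission
  imports Defs
begin

text \<open>
  For fixed \<open>x, y\<close> the elements \<open>z\<close> associating with them are the fixed points of the left inner
  mapping \<open>L(x,y)\<close>, which is an automorphism because conjugacy closedness makes every
  \<open>L\<^sub>x\<close> the last two components of an autotopism; dually for fixed \<open>y, z\<close>. A proper subloop of a
  finite loop contains at most half of the elements, so such a line of triples is either full or at
  most half full. Now fix \<open>y\<close> first: at most half of all \<open>y\<close> are in the middle nucleus, for any other
  \<open>y\<close> at most half of all \<open>z\<close> associate with \<open>y\<close> and every \<open>x\<close>, and for any other \<open>z\<close> at most half of
  all \<open>x\<close> associate with \<open>y, z\<close>. This gives
  \<open>1/2 + 1/2 * (1/2 + 1/2 * 1/2) = 7/8\<close>.
\<close>

context quasigroup
begin

lemma left_cancel: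
  "\<lbrakk>a \<otimes> x = a \<otimes> y; a \<in> carrier G; x \<in> carrier G; y \<in> carrier G\<rbrakk> \<Longrightarrow> x = y"
  using left_div[of a "a \<otimes> y"] by auto

lemma right_cancel:
  "\<lbrakk>x \<otimes> a = y \<otimes> a; a \<in> carrier G; x \<in> carrier G; y \<in> carrier G\<rbrakk> \<Longrightarrow> x = y"
  using right_div[of a "y \<otimes> a"] by auto

text \<open>Stands in for Lagrange's theorem. For \<open>a\<close> outside \<open>H\<close>, the
  translate of \<open>H\<close> by \<open>a\<close> has the size of \<open>H\<close> and misses
  \<open>H\<close>: each \<open>h\<close> in \<open>H\<close> permutes the finite set
  \<open>H\<close> by right multiplication, so \<open>a \<otimes> h\<close> in \<open>H\<close>
  would force \<open>a\<close> into \<open>H\<close>.\<close>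

lemma card_closed_proper_subset_le:
  assumes fin: "finite (carrier G)" and H: "H \<subset> carrier G"
    and closed: "\<And>h k. \<lbrakk>h \<in> H; k \<in> H\<rbrakk> \<Longrightarrow> h \<otimes> k \<in> H"
  shows "2 * card H \<le> card (carrier G)"
proof -
  obtain a where a: "a \<in> carrier G" "a \<notin> H" using H by blast
  have finH: "finite H" using H fin finite_subset by blast
  have "a \<otimes> h \<notin> H" if h: "h \<in> H" for h
  proof
    assume ah: "a \<otimes> h \<in> H"
    have "inj_on (\<lambda>t. t \<otimes> h) H"
      using h H right_cancel by (fastforce intro: inj_onI)
    moreover have "(\<lambda>t. t \<otimes> h) ` H \<subseteq> H" using closed h by blast
    ultimately have "(\<lambda>t. t \<otimes> h) ` H = H" using finH by (simp add: endo_inj_surj)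
    then obtain t where "t \<in> H" "t \<otimes> h = a \<otimes> h" using ah by (metis imageE)
    then show False using right_cancel[of t h a] a h H by blast
  qed
  then have disj: "(\<lambda>h. a \<otimes> h) ` H \<inter> H = {}" by blast
  have inj: "inj_on (\<lambda>h. a \<otimes> h) H"
    using a H left_cancel by (fastforce intro: inj_onI)
  have "card ((\<lambda>h. a \<otimes> h) ` H \<union> H) \<le> card (carrier G)"
    using a H fin by (intro card_mono) auto
  then show ?thesis
    using card_Un_disjoint[OF finite_imageI[OF finH] finH disj] card_image[OF inj] by simp
qed

end

context cc_loop
begin

text \<open>Hides \<open>inv_into\<close>: \<open>f\<close> is the map \<open>x\<close> to
  R_z^{-1}(zx), and the last property makes (f, L_z, L_z) an autotopism.\<close>

lemma left_conjugate:
  assumes "z \<in> carrier G"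
  obtains f where "\<And>x. x \<in> carrier G \<Longrightarrow> f x \<in> carrier G"
    and "\<And>x. x \<in> carrier G \<Longrightarrow> f x \<otimes> z = z \<otimes> x"
    and "\<And>x y. \<lbrakk>x \<in> carrier G; y \<in> carrier G\<rbrakk> \<Longrightarrow> z \<otimes> (x \<otimes> y) = f x \<otimes> (z \<otimes> y)"
proof
  let ?f = "\<lambda>x. inv_into (carrier G) (right_translation G z) (z \<otimes> x)"
  have im: "right_translation G z ` carrier G = carrier G"
    using bij_betw_right_translation[OF assms] by (simp add: bij_betw_def)
  show "?f x \<in> carrier G" if "x \<in> carrier G" for x
    using that assms im by (intro inv_into_into) auto
  show "?f x \<otimes> z = z \<otimes> x" if "x \<in> carrier G" for x
    using that assms im f_inv_into_f[of "z \<otimes> x" "right_translation G z" "carrier G"]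
    by (simp add: right_translation_def)
  show "z \<otimes> (x \<otimes> y) = ?f x \<otimes> (z \<otimes> y)" if "x \<in> carrier G" "y \<in> carrier G" for x y
    using left_cc that assms by blast
qed

lemma right_conjugate:
  assumes "z \<in> carrier G"
  obtains f where "\<And>y. y \<in> carrier G \<Longrightarrow> f y \<in> carrier G"
    and "\<And>y. y \<in> carrier G \<Longrightarrow> z \<otimes> f y = y \<otimes> z"
    and "\<And>x y. \<lbrakk>x \<in> carrier G; y \<in> carrier G\<rbrakk> \<Longrightarrow> (x \<otimes> y) \<otimes> z = (x \<otimes> z) \<otimes> f y"
proof
  let ?f = "\<lambda>y. inv_into (carrier G) (left_translation G z) (y \<otimes> z)"
  have im: "left_translation G z ` carrier G = carrier G"
    using bij_betw_left_translation[OF assms] by (simp add: bij_betw_def)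
  show "?f y \<in> carrier G" if "y \<in> carrier G" for y
    using that assms im by (intro inv_into_into) auto
  show "z \<otimes> ?f y = y \<otimes> z" if "y \<in> carrier G" for y
    using that assms im f_inv_into_f[of "y \<otimes> z" "left_translation G z" "carrier G"]
    by (simp add: left_translation_def)
  show "(x \<otimes> y) \<otimes> z = (x \<otimes> z) \<otimes> ?f y" if "x \<in> carrier G" "y \<in> carrier G" for x y
    using right_cc that assms by blast
qed

text \<open>Both (fg, L_x L_y, L_x L_y) and (h, L_{xy}, L_{xy}) are autotopisms. If their first
  components agree at \<open>u\<close> and their second components at \<open>v\<close>, they agree
  on the product \<open>u \<otimes> v\<close>.\<close>

lemma associating_right_closed:
  assumes c: "x \<in> carrier G" "y \<in> carrier G" "u \<in> carrier G" "v \<in> carrier G"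
    and u: "(x \<otimes> y) \<otimes> u = x \<otimes> (y \<otimes> u)" and v: "(x \<otimes> y) \<otimes> v = x \<otimes> (y \<otimes> v)"
  shows "(x \<otimes> y) \<otimes> (u \<otimes> v) = x \<otimes> (y \<otimes> (u \<otimes> v))"
proof -
  obtain f where f: "\<And>a. a \<in> carrier G \<Longrightarrow> f a \<in> carrier G"
    "\<And>a b. \<lbrakk>a \<in> carrier G; b \<in> carrier G\<rbrakk> \<Longrightarrow> x \<otimes> (a \<otimes> b) = f a \<otimes> (x \<otimes> b)"
    using left_conjugate[OF c(1)] by metis
  obtain g where g: "\<And>a. a \<in> carrier G \<Longrightarrow> g a \<in> carrier G"
    "\<And>a. a \<in> carrier G \<Longrightarrow> g a \<otimes> y = y \<otimes> a"
    "\<And>a b. \<lbrakk>a \<in> carrier G; b \<in> carrier G\<rbrakk> \<Longrightarrow> y \<otimes> (a \<otimes> b) = g a \<otimes> (y \<otimes> b)"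
    using left_conjugate[OF c(2)] by metis
  have xy: "x \<otimes> y \<in> carrier G" using c by simp
  obtain h where h: "\<And>a. a \<in> carrier G \<Longrightarrow> h a \<in> carrier G"
    "\<And>a. a \<in> carrier G \<Longrightarrow> h a \<otimes> (x \<otimes> y) = (x \<otimes> y) \<otimes> a"
    "\<And>a b. \<lbrakk>a \<in> carrier G; b \<in> carrier G\<rbrakk> \<Longrightarrow>
      (x \<otimes> y) \<otimes> (a \<otimes> b) = h a \<otimes> ((x \<otimes> y) \<otimes> b)"
    using left_conjugate[OF xy] by metis
  \<comment> \<open>That \<open>u\<close> associates with \<open>x, y\<close> is turned into
    agreement of the first components by cancelling \<open>x \<otimes> y\<close>.\<close>
  have "f (g u) \<otimes> (x \<otimes> y) = x \<otimes> (y \<otimes> u)" using c f(2)[of "g u" y] g by simp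
  also have "\<dots> = h u \<otimes> (x \<otimes> y)" using c h(2) u by simp
  finally have "f (g u) = h u" by (rule right_cancel) (use c f(1) g(1) h(1) in auto)
  then show ?thesis using c f(2)[of "g u" "y \<otimes> v"] g(1,3) h(3) v by simp
qed

text \<open>Mirror image of the previous argument: now R_z R_y and R_{yz} are compared at
  \<open>u\<close>, and the conjugating maps at \<open>v\<close>.\<close>

lemma associating_left_closed:
  assumes c: "y \<in> carrier G" "z \<in> carrier G" "u \<in> carrier G" "v \<in> carrier G"
    and u: "(u \<otimes> y) \<otimes> z = u \<otimes> (y \<otimes> z)" and v: "(v \<otimes> y) \<otimes> z = v \<otimes> (y \<otimes> z)"
  shows "((u \<otimes> v) \<otimes> y) \<otimes> z = (u \<otimes> v) \<otimes> (y \<otimes> z)"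
proof -
  obtain f where f: "\<And>a. a \<in> carrier G \<Longrightarrow> f a \<in> carrier G"
    "\<And>a b. \<lbrakk>a \<in> carrier G; b \<in> carrier G\<rbrakk> \<Longrightarrow> (a \<otimes> b) \<otimes> z = (a \<otimes> z) \<otimes> f b"
    using right_conjugate[OF c(2)] by metis
  obtain g where g: "\<And>a. a \<in> carrier G \<Longrightarrow> g a \<in> carrier G"
    "\<And>a. a \<in> carrier G \<Longrightarrow> y \<otimes> g a = a \<otimes> y"
    "\<And>a b. \<lbrakk>a \<in> carrier G; b \<in> carrier G\<rbrakk> \<Longrightarrow> (a \<otimes> b) \<otimes> y = (a \<otimes> y) \<otimes> g b"
    using right_conjugate[OF c(1)] by metis
  have yz: "y \<otimes> z \<in> carrier G" using c by simp
  obtain h where h: "\<And>a. a \<in> carrier G \<Longrightarrow> h a \<in> carrier G"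
    "\<And>a. a \<in> carrier G \<Longrightarrow> (y \<otimes> z) \<otimes> h a = a \<otimes> (y \<otimes> z)"
    "\<And>a b. \<lbrakk>a \<in> carrier G; b \<in> carrier G\<rbrakk> \<Longrightarrow>
      (a \<otimes> b) \<otimes> (y \<otimes> z) = (a \<otimes> (y \<otimes> z)) \<otimes> h b"
    using right_conjugate[OF yz] by metis
  have "(y \<otimes> z) \<otimes> f (g v) = (v \<otimes> y) \<otimes> z" using c f(2)[of y "g v"] g by simp
  also have "\<dots> = (y \<otimes> z) \<otimes> h v" using c h(2) v by simp
  finally have "f (g v) = h v" by (rule left_cancel) (use c f(1) g(1) h(1) in auto)
  then show ?thesis using c f(2)[of "u \<otimes> y" "g v"] g(1,3) h(3) u by simp
qed

end

lemma sum_le_average: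
  fixes f :: "'a \<Rightarrow> real"
  assumes fin: "finite A" and S: "S \<subseteq> A" and half: "2 * card S \<le> card A"
    and le: "\<And>x. x \<in> A \<Longrightarrow> f x \<le> M" and le': "\<And>x. x \<in> A - S \<Longrightarrow> f x \<le> c * M"
    and "c \<le> 1" "0 \<le> M"
  shows "sum f A \<le> (1 + c) / 2 * (real (card A) * M)"
proof -
  have finS: "finite S" using S fin finite_subset by blast
  have "sum f A = sum f (A - S) + sum f S" using sum.subset_diff[OF S fin] .
  also have "\<dots> \<le> real (card (A - S)) * (c * M) + real (card S) * M"
    using S le le' by (intro add_mono sum_bounded_above) auto
  also have "real (card (A - S)) = real (card A) - real (card S)"
    using S fin by (simp add: card_Diff_subset card_mono finS of_nat_diff)
  \<comment> \<open>Collecting the terms in \<open>card S\<close> leaves the coefficient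
    \<open>(1 - c) * M \<ge> 0\<close>, so the worst case is an \<open>S\<close> that fills half of
    \<open>A\<close>.\<close>
  also have "(real (card A) - real (card S)) * (c * M) + real (card S) * M =
      real (card A) * (c * M) + real (card S) * ((1 - c) * M)"
    by (simp add: algebra_simps)
  also have "\<dots> \<le> real (card A) * (c * M) + real (card A) / 2 * ((1 - c) * M)"
    using half assms(6,7) by (intro add_left_mono mult_right_mono) auto
  also have "\<dots> = (1 + c) / 2 * (real (card A) * M)" by (simp add: field_simps)
  finally show ?thesis .
qed

theorem theorem3p1:
  fixes G (structure)
  assumes "cc_loop G"
    and "finite (carrier G)"
    and "\<exists>x\<in>carrier G. \<exists>y\<in>carrier G. \<exists>z\<in>carrier G. (x \<otimes> y) \<otimes> z \<noteq> x \<otimes> (y \<otimes> z)"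
  shows "real (card {(x, y, z). x \<in> carrier G \<and> y \<in> carrier G \<and> z \<in> carrier G \<and>
           (x \<otimes> y) \<otimes> z = x \<otimes> (y \<otimes> z)}) / real (card (carrier G)) ^ 3 \<le> 7 / 8"
proof -
  interpret cc_loop G by fact
  let ?C = "carrier G" and ?n = "real (card (carrier G))"
  note fin = assms(2)
  \<comment> \<open>\<open>D y\<close> collects the \<open>z\<close> for which the line
    \<open>X y z\<close> is full; \<open>N\<close> is the middle nucleus, the \<open>y\<close> for
    which \<open>D y\<close> is everything.\<close>
  define X where "X y z = {x \<in> ?C. (x \<otimes> y) \<otimes> z = x \<otimes> (y \<otimes> z)}" for y z
  define D where "D y = {z \<in> ?C. \<forall>x\<in>?C. (x \<otimes> y) \<otimes> z = x \<otimes> (y \<otimes> z)}" for y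
  define N where "N = {y \<in> ?C. \<forall>x\<in>?C. \<forall>z\<in>?C. (x \<otimes> y) \<otimes> z = x \<otimes> (y \<otimes> z)}"
  have finX: "finite (X y z)" for y z using fin by (simp add: X_def)
  have X_le: "card (X y z) \<le> card ?C" for y z
    using fin by (auto simp: X_def intro: card_mono)
  have X_half: "real (card (X y z)) \<le> 1 / 2 * ?n" if "y \<in> ?C" "z \<in> ?C - D y" for y z
  proof -
    have "2 * card (X y z) \<le> card ?C"
      using that by (intro card_closed_proper_subset_le fin)
        (auto simp: X_def D_def associating_left_closed)
    then show ?thesis by linarith
  qed
  have D_half: "2 * card (D y) \<le> card ?C" if "y \<in> ?C - N" for y
    using that by (intro card_closed_proper_subset_le fin)
      (auto simp: D_def N_def associating_right_closed)
  \<comment> \<open>(x(ab))z = ((xa)b)z = (xa)(bz) = x(a(bz)) = x((ab)z).\<close>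
  have "a \<otimes> b \<in> N" if "a \<in> N" "b \<in> N" for a b
    using that by (simp add: N_def) (metis m_closed)
  moreover have "N \<subset> ?C" using assms(3) by (auto simp: N_def)
  ultimately have N_half: "2 * card N \<le> card ?C"
    by (intro card_closed_proper_subset_le fin)
  have plane_le: "(\<Sum>z\<in>?C. real (card (X y z))) \<le> ?n * ?n" for y
    using X_le by (intro sum_bounded_above) simp
  \<comment> \<open>Averaging with exceptional set \<open>D y\<close> and \<open>c = 1/2\<close>
    gives (1 + 1/2)/2 = 3/4; next, \<open>N\<close> and \<open>c = 3/4\<close> give (1 + 3/4)/2 =
    7/8.\<close>
  have plane: "(\<Sum>z\<in>?C. real (card (X y z))) \<le> 3 / 4 * (?n * ?n)" if "y \<in> ?C - N" for y
    using sum_le_average[OF fin _ D_half[OF that], of "\<lambda>z. real (card (X y z))" ?n "1 / 2"]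
      X_half[of y] X_le that by (simp add: D_def)
  have total: "(\<Sum>y\<in>?C. \<Sum>z\<in>?C. real (card (X y z))) \<le> 7 / 8 * (?n * (?n * ?n))"
    using sum_le_average[OF fin _ N_half, of "\<lambda>y. \<Sum>z\<in>?C. real (card (X y z))" "?n * ?n" "3 / 4"]
      plane_le plane by (simp add: N_def)
  let ?T = "{(x, y, z). x \<in> ?C \<and> y \<in> ?C \<and> z \<in> ?C \<and> (x \<otimes> y) \<otimes> z = x \<otimes> (y \<otimes> z)}"
  \<comment> \<open>Reordering the coordinates makes \<open>y\<close> outermost and \<open>x\<close>
    innermost, matching the double sum.\<close>
  have "bij_betw (\<lambda>(y, z, x). (x, y, z)) (SIGMA y:?C. SIGMA z:?C. X y z) ?T"
    by (rule bij_betw_byWitness[where f' = "\<lambda>(x, y, z). (y, z, x)"]) (auto simp: X_def)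
  then have "card ?T = card (SIGMA y:?C. SIGMA z:?C. X y z)"
    by (simp add: bij_betw_same_card)
  also have "\<dots> = (\<Sum>y\<in>?C. \<Sum>z\<in>?C. card (X y z))"
    using fin finX by simp
  finally have "real (card ?T) \<le> 7 / 8 * ?n ^ 3"
    using total by (simp add: power3_eq_cube mult.assoc)
  moreover have "0 < ?n" using fin one_closed by (auto simp: card_gt_0_iff)
  ultimately show ?thesis by (simp add: divide_le_eq)
qed

end
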